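(* Consider the problem of maximizing, over the rate margins $\bar{\mathbf r}=[\bar r_1,\dots,\bar r_K]^{\mathrm T}$, the energy efficiency (EE) $$\frac{Kr+\sum_{k\in\mathcal K}\bar r_k}{\frac1\rho\sum_{k\in\mathcal K}\frac{2^{r+\bar r_k}-1}{\omega_k}+P_{\mathrm{cir}}^{\mathrm{SLM}}}$$ subject to $$\sum_{k\in\mathcal K}\frac{2^{r+\bar r_k}-1}{\omega_k}\le P_{\mathrm T},\qquad \bar{\mathbf r}\ge\mathbf 0 .$$ Let $\mathcal K'\subseteq\mathcal K$ denote the nonzero rate-margin set containing the $K'\le K$ users satisfying $\bar r_k>0$, where $|\mathcal K'|=K'$. The optimal EE is then given by $$\eta^{\mathrm{SLM}}=\frac{K'}{A_{\mathcal K'}\ln(2)}\,W\!\left(\frac{A_{\mathcal K'}\ln(2)}{K'}\exp\!\Big(\frac{B_{\mathcal K'}\ln(2)}{K'}-1\Big)\right),\qquad( * )$$ where $W(\cdot)$ denotes the Lambert-$W$ function, and $$A_{\mathcal K'}=P_{\mathrm{cir}}^{\mathrm{SLM}}+\frac1\rho\sum_{k\notin\mathcal K'}\frac{2^r-1}{\omega_k}-\frac1\rho\sum_{k\in\mathcal K'}\frac1{\omega_k},$$ $$B_{\mathcal K'}=(K-K')r+\sum_{k\in\mathcal K'}\log_2(\omega_k)+K'\log_2\!\Big(\frac{\rho}{\ln(2)}\Big).$$ The corresponding optimal rate margins are $$\bar r_k=\begin{cases}\log_2\!\Big(\dfrac{\rho\,\omega_k}{\lambda\ln(2)}\Big)-r,&k\in\mathcal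 K',\\[1ex]0,&k\notin\mathcal K',\end{cases}$$ where $\lambda=\eta^{\mathrm{SLM}}$. The obtained solution is feasible if and only if $$\sum_{k\in\mathcal K}\frac{2^{\bar r_k}}{\omega_k}\le 2^{-r}\Big(P_{\mathrm T}+\sum_{k\in\mathcal K}\frac1{\omega_k}\Big).$$ For $K'=0$, the expression $( * )$ is $\lim_{K'\to0}\eta^{\mathrm{SLM}}=B_\emptyset/A_\emptyset$, which reduces to $$\eta^{\mathrm{SLM}}\big|_{K'=0}=\frac{Kr}{\frac1\rho\sum_{k\in\mathcal K}\frac{2^r-1}{\omega_k}+P_{\mathrm{cir}}^{\mathrm{SLM}}},$$ i.e., all users are served at exactly their minimum rate $r$.
   Context: A base station with $N$ antennas and a single-layer microwave linear analog computer (SLM) architecture serves the $K$ single-antenna users in $\mathcal K=\{1,\dots,K\}$. The user channels $\mathbf h_k$ are assumed mutually orthogonal, quantization noise is neglected, and maximum ratio transmission is used. Then $\omega_k=\|\mathbf h_k\|_2^2/\sigma^2$ with $\sigma^2$ the noise power; user $k$ with transmit power $\xi_k$ has rate $\log_2(1+\xi_k\omega_k)$, and writing this rate as $r+\bar r_k$ (minimum required rate $r$ plus nonnegative rate margin $\bar r_k$) gives $\xi_k=(2^{r+\bar r_k}-1)/\omega_k$. Here $\rho$ is the power amplifier efficiency, $P_{\mathrm T}$ the transmit power budget, and $P_{\mathrm{cir}}^{\mathrm{SLM}}>0$ the circuit power, which does not depend on $\bar{\mathbf r}$. The EE is the sum rate divided by the total power $\frac1\rho\sum_{k}\xi_k+P_{\mathrm{cir}}^{\mathrm{SLM}}$.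 The parameter $\lambda$ is the optimal Dinkelbach parameter of this fractional program, which equals the optimal EE.
   Formalization: The solution is the maximizer over nonnegative margins without the power budget; it is claimed optimal for the full problem only when it meets the budget, since ( * ) fails if the budget binds. For A = 0 with K' nonempty, where ( * ) is 0/0, it is read as the limit A → 0. *)

theory Defs
  imports "HOL-Analysis.Analysis"
begin

text \<open>
  Users are the indices in \<open>{1..K}\<close>; \<open>r\<close> is the minimum rate, \<open>\<omega> k\<close> the channel-to-noise ratio of
  user \<open>k\<close>, \<open>\<rho>\<close> the power amplifier efficiency, \<open>Pc\<close> the circuit power and \<open>PT\<close> the transmit power
  budget. A rate-margin vector is a function \<open>x\<close>, of which only the values on \<open>{1..K}\<close> matter.
\<close>

definition tx_power :: "nat \<Rightarrow> real \<Rightarrow> (nat \<Rightarrow> real) \<Rightarrow> (nat \<Rightarrow> real) \<Rightarrow> real" where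
  "tx_power K r \<omega> x = (\<Sum>k\<in>{1..K}. (2 powr (r + x k) - 1) / \<omega> k)"

definition EE :: "nat \<Rightarrow> real \<Rightarrow> (nat \<Rightarrow> real) \<Rightarrow> real \<Rightarrow> real \<Rightarrow> (nat \<Rightarrow> real) \<Rightarrow> real" where
  "EE K r \<omega> \<rho> Pc x =
     (real K * r + (\<Sum>k\<in>{1..K}. x k)) / (1 / \<rho> * tx_power K r \<omega> x + Pc)"

definition nonneg_margins :: "nat \<Rightarrow> (nat \<Rightarrow> real) set" where
  "nonneg_margins K = {x. \<forall>k\<in>{1..K}. 0 \<le> x k}"

definition feasible_margins ::
  "nat \<Rightarrow> real \<Rightarrow> (nat \<Rightarrow> real) \<Rightarrow> real \<Rightarrow> (nat \<Rightarrow> real) set" where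
  "feasible_margins K r \<omega> PT = {x. tx_power K r \<omega> x \<le> PT \<and> (\<forall>k\<in>{1..K}. 0 \<le> x k)}"

definition active_users :: "nat \<Rightarrow> (nat \<Rightarrow> real) \<Rightarrow> nat set" where
  "active_users K x = {k\<in>{1..K}. x k > 0}"

text \<open>
  Principal real branch of the Lambert function, meaningful for \<open>z \<ge> - exp (- 1)\<close>. The argument may
  be negative below, since \<open>A_coeff\<close> may be; the principal branch is then the relevant one because
  the total consumed power is positive.
\<close>

definition Lambert_W :: "real \<Rightarrow> real" where
  "Lambert_W z = (THE w. - 1 \<le> w \<and> w * exp w = z)"

definition A_coeff ::
  "nat \<Rightarrow> real \<Rightarrow> (nat \<Rightarrow> real) \<Rightarrow> real \<Rightarrow> real \<Rightarrow> nat set \<Rightarrow> real" where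
  "A_coeff K r \<omega> \<rho> Pc S =
     Pc + 1 / \<rho> * (\<Sum>k\<in>{1..K} - S. (2 powr r - 1) / \<omega> k) - 1 / \<rho> * (\<Sum>k\<in>S. 1 / \<omega> k)"

text \<open>
  The number of active users is a separate real argument \<open>\<kappa>\<close> of the next two definitions, so that
  the limit \<open>\<kappa> \<longlongrightarrow> 0\<close> can be expressed; for a set \<open>S\<close> of active users, \<open>\<kappa> = card S\<close>.
\<close>

definition B_coeff ::
  "nat \<Rightarrow> real \<Rightarrow> (nat \<Rightarrow> real) \<Rightarrow> real \<Rightarrow> real \<Rightarrow> nat set \<Rightarrow> real" where
  "B_coeff K r \<omega> \<rho> \<kappa> S =
     (real K - \<kappa>) * r + (\<Sum>k\<in>S. log 2 (\<omega> k)) + \<kappa> * log 2 (\<rho> / ln 2)"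

definition eta_SLM :: "real \<Rightarrow> real \<Rightarrow> real \<Rightarrow> real" where
  "eta_SLM \<kappa> A B = \<kappa> / (A * ln 2) * Lambert_W (A * ln 2 / \<kappa> * exp (B * ln 2 / \<kappa> - 1))"

end

theory Submission
  imports Defs
begin

text \<open>
  Dinkelbach's argument: for \<open>\<lambda> > 0\<close> the concave function \<open>N x - \<lambda> * D x\<close> (\<open>N\<close> the sum rate, \<open>D\<close> the
  consumed power) is separable, and its unique maximiser over the nonnegative margins is
  \<open>x k = max 0 (log 2 (\<rho> * \<omega> k / (\<lambda> * ln 2)) - r)\<close>. Its maximal value is continuous in \<open>\<lambda>\<close>,
  positive for small and negative for large \<open>\<lambda>\<close>, so it vanishes at some \<open>\<lambda>\<close>, which is the optimal
  EE. Inserting the maximiser into \<open>N x = \<lambda> * D x\<close> gives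
  \<open>\<lambda> * A * ln 2 / \<kappa> + ln \<lambda> = B * ln 2 / \<kappa> - 1\<close>, which the Lambert function solves. It is the principal
  branch because \<open>D x > 0\<close> means \<open>\<lambda> * A * ln 2 / \<kappa> > - 1\<close>.
\<close>

section \<open>The principal branch of the Lambert function\<close>

text \<open>The derivative \<open>(1 + x) * exp x\<close> is positive to the right of -1. This is
  what makes the definite description in \<open>Lambert_W\<close> unique.\<close>

lemma mult_exp_strict_mono:
  fixes v w :: real
  assumes "- 1 \<le> v" and "v < w"
  shows "v * exp v < w * exp w"
proof (rule DERIV_pos_imp_increasing_open[OF assms(2)])
  fix x :: real
  assume "v < x" "x < w"
  have "((\<lambda>x. x * exp x) has_real_derivative (1 + x) * exp x) (at x)"
    by (auto intro!: derivative_eq_intros simp: algebra_simps)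
  moreover have "(1 + x) * exp x > 0"
    using assms(1) \<open>v < x\<close> by simp
  ultimately show "\<exists>y. ((\<lambda>x. x * exp x) has_real_derivative y) (at x) \<and> y > 0"
    by blast
qed (intro continuous_intros)

lemma Lambert_W_eqI:
  assumes "- 1 \<le> w" and "w * exp w = z"
  shows "Lambert_W z = w"
  unfolding Lambert_W_def
proof (rule the_equality)
  fix v assume "- 1 \<le> v \<and> v * exp v = z"
  then show "v = w"
    using assms mult_exp_strict_mono[of v w] mult_exp_strict_mono[of w v]
    by (cases v w rule: linorder_cases) auto
qed (use assms in simp)

text \<open>Existence comes from the intermediate value theorem on the interval from -1 to
  \<open>\<bar>z\<bar>\<close>: the left value is \<open>- exp (- 1)\<close>, the right value is at
  least \<open>z\<close>.\<close>

lemma Lambert_W_props: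
  assumes "- exp (- 1) \<le> z"
  shows "- 1 \<le> Lambert_W z" and "Lambert_W z * exp (Lambert_W z) = z"
proof -
  have "z \<le> \<bar>z\<bar> * 1" by simp
  also have "\<dots> \<le> \<bar>z\<bar> * exp \<bar>z\<bar>"
    by (intro mult_left_mono) auto
  finally have "\<exists>w\<ge>- 1. w \<le> \<bar>z\<bar> \<and> w * exp w = z"
    using assms by (intro IVT') (auto intro!: continuous_intros)
  then obtain w where w: "- 1 \<le> w" "w * exp w = z" by blast
  then have "Lambert_W z = w" by (rule Lambert_W_eqI)
  with w show "- 1 \<le> Lambert_W z" and "Lambert_W z * exp (Lambert_W z) = z" by simp_all
qed

lemma Lambert_W_pos:
  assumes "0 < z"
  shows "0 < Lambert_W z"
proof -
  have "- exp (- 1) \<le> z" using assms by (smt (verit) exp_gt_zero)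
  from Lambert_W_props(2)[OF this] assms show ?thesis
    by (smt (verit) exp_gt_zero mult_nonpos_nonneg)
qed

text \<open>On the principal branch \<open>exp (Lambert_W z)\<close> is at least
  \<open>exp (- 1)\<close>, so \<open>Lambert_W z * exp (Lambert_W z) = z\<close> bounds the
  function linearly.\<close>

lemma Lambert_W_tendsto_0: "(Lambert_W \<longlongrightarrow> 0) (at 0)"
proof (rule Lim_null_comparison)
  have "\<forall>\<^sub>F z in at (0::real). - exp (- 1) < z"
    by (rule order_tendstoD[OF tendsto_ident_at]) simp
  then show "\<forall>\<^sub>F z in at 0. norm (Lambert_W z) \<le> exp 1 * \<bar>z\<bar>"
  proof eventually_elim
    case (elim z)
    note W = Lambert_W_props[OF less_imp_le[OF elim]]
    have "exp (- 1) * \<bar>Lambert_W z\<bar> \<le> exp (Lambert_W z) * \<bar>Lambert_W z\<bar>"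
      using W(1) by (intro mult_right_mono) auto
    also have "\<dots> = \<bar>z\<bar>"
      using arg_cong[OF W(2), of abs] by (simp add: abs_mult mult.commute)
    finally show ?case
      by (simp add: exp_minus field_simps)
  qed
  show "((\<lambda>z. exp 1 * \<bar>z\<bar>) \<longlongrightarrow> 0) (at (0::real))"
    by (auto intro!: tendsto_eq_intros)
qed

text \<open>For nonzero \<open>z\<close> the quotient equals
  \<open>exp (- Lambert_W z)\<close>.\<close>

lemma Lambert_W_div_tendsto_1: "((\<lambda>z. Lambert_W z / z) \<longlongrightarrow> 1) (at 0)"
proof (rule Lim_transform_eventually)
  show "((\<lambda>z. exp (- Lambert_W z)) \<longlongrightarrow> 1) (at 0)"
    by (rule tendsto_eq_intros Lambert_W_tendsto_0 | simp)+
  have "\<forall>\<^sub>F z in at (0::real). - exp (- 1) < z"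
    by (rule order_tendstoD[OF tendsto_ident_at]) simp
  moreover have "\<forall>\<^sub>F z in at (0::real). z \<noteq> 0"
    by (simp add: eventually_at_filter)
  ultimately show "\<forall>\<^sub>F z in at 0. exp (- Lambert_W z) = Lambert_W z / z"
  proof eventually_elim
    case (elim z)
    from Lambert_W_props(2)[OF less_imp_le[OF elim(1)]] elim(2) show ?case
      by (simp add: exp_minus field_simps)
  qed
qed

section \<open>The closed form of the EE and its degenerate cases\<close>

text \<open>Serves the case \<open>A = 0\<close> with active users, where \<open>eta_SLM\<close> is
  0 by the convention for division by zero and the closed form has to be read as a limit.\<close>

lemma eta_SLM_tendsto_at_0:
  assumes "0 < \<kappa>"
  shows "((\<lambda>a. eta_SLM \<kappa> a B) \<longlongrightarrow> exp (B * ln 2 / \<kappa> - 1)) (at 0)"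
proof -
  define E where "E = exp (B * ln 2 / \<kappa> - 1)"
  have E: "E > 0" by (simp add: E_def)
  define c where "c = ln 2 / \<kappa> * E"
  have c: "c \<noteq> 0" using assms E by (simp add: c_def)
  have "filterlim (\<lambda>a. c * a) (at 0) (at 0)"
    unfolding filterlim_at using c
    by (auto intro!: tendsto_eq_intros simp: eventually_at_filter)
  then have "((\<lambda>a. Lambert_W (c * a) / (c * a)) \<longlongrightarrow> 1) (at 0)"
    by (rule filterlim_compose[OF Lambert_W_div_tendsto_1])
  then have "((\<lambda>a. E * (Lambert_W (c * a) / (c * a))) \<longlongrightarrow> E * 1) (at 0)"
    by (intro tendsto_intros)
  \<comment> \<open>This holds even at \<open>a = 0\<close>, where both sides are 0.\<close>
  moreover have "eta_SLM \<kappa> a B = E * (Lambert_W (c * a) / (c * a))" for a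
    using assms E by (simp add: eta_SLM_def c_def E_def[symmetric] mult_ac)
  ultimately show ?thesis by (simp add: E_def)
qed

text \<open>With \<open>w\<close> proportional to \<open>l * A\<close>, the equation reads
  \<open>w + ln l = B * ln 2 / \<kappa> - 1\<close>; exponentiating gives the Lambert equation for
  \<open>w\<close>. The positivity hypothesis puts \<open>w\<close> above -1.\<close>

lemma eta_SLM_eqI:
  assumes "0 < \<kappa>" and "0 < l" and "A \<noteq> 0" and "0 < A + \<kappa> / (l * ln 2)"
    and eq: "l * A + \<kappa> / ln 2 = B - \<kappa> * log 2 l"
  shows "eta_SLM \<kappa> A B = l"
proof -
  define w where "w = l * A * ln 2 / \<kappa>"
  have "w + 1 = (A + \<kappa> / (l * ln 2)) * (l * ln 2 / \<kappa>)"
    using assms by (simp add: w_def field_simps)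
  also have "\<dots> > 0"
    using assms by (intro mult_pos_pos) auto
  finally have w1: "- 1 \<le> w" by simp
  have "w + 1 = (l * A + \<kappa> / ln 2) * ln 2 / \<kappa>"
    using assms by (simp add: w_def field_simps)
  also have "\<dots> = B * ln 2 / \<kappa> - ln l"
    unfolding eq using assms by (simp add: log_def field_simps)
  finally have "B * ln 2 / \<kappa> - 1 = w + ln l" by simp
  then have "exp (B * ln 2 / \<kappa> - 1) = exp w * l"
    using assms by (simp add: exp_add)
  then have "w * exp w = A * ln 2 / \<kappa> * exp (B * ln 2 / \<kappa> - 1)"
    by (simp add: w_def)
  from Lambert_W_eqI[OF w1 this] assms show ?thesis
    by (simp add: eta_SLM_def w_def)
qed

text \<open>For \<open>t > 0\<close> the map \<open>v + t * ln v\<close> increases in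
  \<open>v > 0\<close>, and for a constant \<open>c\<close> it tends to \<open>c\<close>. Comparing
  \<open>u t\<close> with constants on either side of \<open>L\<close> therefore removes the
  logarithmic perturbation.\<close>

lemma tendsto_of_tendsto_add_mult_ln:
  fixes u :: "real \<Rightarrow> real"
  assumes pos: "\<forall>\<^sub>F t in at_right 0. 0 < u t"
    and lim: "((\<lambda>t. u t + t * ln (u t)) \<longlongrightarrow> L) (at_right 0)"
    and "0 \<le> L"
  shows "(u \<longlongrightarrow> L) (at_right 0)"
proof (rule order_tendstoI)
  have lim_const: "((\<lambda>t. c + t * ln c) \<longlongrightarrow> c) (at_right 0)" for c :: real
    by (auto intro!: tendsto_eq_intros)
  have t_pos: "\<forall>\<^sub>F t in at_right 0. 0 < (t::real)"
    by (simp add: eventually_at_right_less)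
  show "\<forall>\<^sub>F t in at_right 0. a < u t" if "a < L" for a
  proof (cases "0 < a")
    case True
    \<comment> \<open>The number \<open>m\<close> separates the limits \<open>a\<close> and
      \<open>L\<close> of the two perturbed expressions; \<open>u t \<le> a\<close> would reverse
      their order.\<close>
    obtain m where m: "a < m" "m < L" using \<open>a < L\<close> dense by blast
    have "\<forall>\<^sub>F t in at_right 0. a + t * ln a < m" "\<forall>\<^sub>F t in at_right 0. m < u t + t * ln (u t)"
      using order_tendstoD[OF lim_const] order_tendstoD[OF lim] m by blast+
    with pos t_pos show ?thesis
    proof eventually_elim
      case (elim t)
      show ?case
      proof (rule ccontr)
        assume "\<not> a < u t"
        then have "u t + t * ln (u t) \<le> a + t * ln a"
          using elim by (intro add_mono mult_left_mono) auto
        with elim show False by linarith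
      qed
    qed
  next
    case False
    from pos show ?thesis by eventually_elim (use False in linarith)
  qed
  show "\<forall>\<^sub>F t in at_right 0. u t < a" if "L < a" for a
  proof -
    obtain m where m: "L < m" "m < a" using \<open>L < a\<close> dense by blast
    have "\<forall>\<^sub>F t in at_right 0. m < a + t * ln a" "\<forall>\<^sub>F t in at_right 0. u t + t * ln (u t) < m"
      using order_tendstoD[OF lim_const] order_tendstoD[OF lim] m by blast+
    with pos t_pos show ?thesis
    proof eventually_elim
      case (elim t)
      show ?case
      proof (rule ccontr)
        assume "\<not> u t < a"
        then have "a + t * ln a \<le> u t + t * ln (u t)"
          using elim \<open>0 \<le> L\<close> \<open>L < a\<close> by (intro add_mono mult_left_mono) auto
        with elim show False by linarith
      qed
    qed
  qed
qed

text \<open>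
  With \<open>u = \<kappa> * W\<close>, taking logarithms in the equation defining \<open>W\<close> gives
  \<open>u + \<kappa> * ln u = \<kappa> * ln (A * ln 2) + B \<kappa> * ln 2 - \<kappa>\<close>: the singular terms \<open>\<kappa> * ln \<kappa>\<close> cancel.
\<close>

lemma eta_SLM_tendsto_at_right_0:
  assumes "0 < A" and "0 \<le> b" and B: "(B \<longlongrightarrow> b) (at_right 0)"
  shows "((\<lambda>\<kappa>. eta_SLM \<kappa> A (B \<kappa>)) \<longlongrightarrow> b / A) (at_right 0)"
proof -
  define u where "u \<kappa> = \<kappa> * Lambert_W (A * ln 2 / \<kappa> * exp (B \<kappa> * ln 2 / \<kappa> - 1))" for \<kappa>
  have \<kappa>_pos: "\<forall>\<^sub>F \<kappa> in at_right 0. 0 < (\<kappa>::real)"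
    by (simp add: eventually_at_right_less)
  have "((\<lambda>\<kappa>. \<kappa> * ln (A * ln 2) + B \<kappa> * ln 2 - \<kappa>) \<longlongrightarrow> b * ln 2) (at_right 0)"
    by (rule tendsto_eq_intros B | simp)+
  moreover have "\<forall>\<^sub>F \<kappa> in at_right 0. \<kappa> * ln (A * ln 2) + B \<kappa> * ln 2 - \<kappa> = u \<kappa> + \<kappa> * ln (u \<kappa>)"
    using \<kappa>_pos
  proof eventually_elim
    case (elim \<kappa>)
    define z where "z = A * ln 2 / \<kappa> * exp (B \<kappa> * ln 2 / \<kappa> - 1)"
    define w where "w = Lambert_W z"
    have z: "0 < z" using elim \<open>0 < A\<close> by (simp add: z_def)
    then have w: "0 < w" by (simp add: w_def Lambert_W_pos)
    have "- exp (- 1) \<le> z" using z by (smt (verit) exp_gt_zero)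
    from Lambert_W_props(2)[OF this] have "ln (w * exp w) = ln z" by (simp add: w_def)
    then have "ln w + w = ln (A * ln 2) - ln \<kappa> + (B \<kappa> * ln 2 / \<kappa> - 1)"
      using w elim \<open>0 < A\<close> by (simp add: z_def ln_mult ln_div)
    then have "\<kappa> * (ln w + w) = \<kappa> * (ln (A * ln 2) - ln \<kappa> + (B \<kappa> * ln 2 / \<kappa> - 1))" by simp
    moreover have "u \<kappa> = \<kappa> * w" by (simp add: u_def w_def z_def)
    moreover have "ln (\<kappa> * w) = ln \<kappa> + ln w" using elim w by (simp add: ln_mult)
    ultimately show ?case using elim by (simp add: algebra_simps)
  qed
  ultimately have lim: "((\<lambda>\<kappa>. u \<kappa> + \<kappa> * ln (u \<kappa>)) \<longlongrightarrow> b * ln 2) (at_right 0)"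
    by (rule Lim_transform_eventually)
  have "\<forall>\<^sub>F \<kappa> in at_right 0. 0 < u \<kappa>"
    using \<kappa>_pos
    by eventually_elim (use \<open>0 < A\<close> in \<open>auto simp: u_def intro!: mult_pos_pos Lambert_W_pos\<close>)
  from tendsto_of_tendsto_add_mult_ln[OF this lim] have "(u \<longlongrightarrow> b * ln 2) (at_right 0)"
    using \<open>0 \<le> b\<close> by simp
  then have "((\<lambda>\<kappa>. u \<kappa> / (A * ln 2)) \<longlongrightarrow> b * ln 2 / (A * ln 2)) (at_right 0)"
    using \<open>0 < A\<close> by (intro tendsto_intros) auto
  moreover have "u \<kappa> / (A * ln 2) = eta_SLM \<kappa> A (B \<kappa>)" for \<kappa>
    by (simp add: u_def eta_SLM_def)
  ultimately show ?thesis by simp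
qed

section \<open>The Dinkelbach problem\<close>

text \<open>Water-filling in terms of rates: the stationary point of the one-user objective
  \<open>t - l / (\<rho> * \<omega> k) * 2 powr (r + t)\<close>, clipped at 0.\<close>

definition dinkelbach_margin :: "real \<Rightarrow> (nat \<Rightarrow> real) \<Rightarrow> real \<Rightarrow> real \<Rightarrow> nat \<Rightarrow> real" where
  "dinkelbach_margin r \<omega> \<rho> l k = max 0 (log 2 (\<rho> * \<omega> k / (l * ln 2)) - r)"

text \<open>The objective is strictly concave: it lies strictly below its tangent at
  \<open>s\<close> away from \<open>s\<close>, and the first-order condition at \<open>s\<close>
  keeps that tangent from rising towards admissible \<open>t\<close>.\<close>

lemma separable_term_less_max:
  fixes c r s t :: real
  assumes "0 < c" and "0 \<le> t" and s: "s = max 0 (log 2 (1 / (c * ln 2)) - r)" and "t \<noteq> s"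
  shows "t - c * 2 powr (r + t) < s - c * 2 powr (r + s)"
proof -
  \<comment> \<open>The slope of the objective at \<open>s\<close> is
    \<open>1 - p * ln 2\<close>.\<close>
  define p where "p = c * 2 powr (r + s)"
  have p: "0 < p" using assms by (simp add: p_def)
  have ineq: "1 + (t - s) * ln 2 < 2 powr (t - s)"
    using exp_minus_greater[of "- ((t - s) * ln 2)"] assms(4) by (simp add: powr_def)
  \<comment> \<open>The slope vanishes if the stationary point is positive; otherwise
    \<open>s = 0\<close>, the slope is nonpositive and \<open>t - s\<close> is nonnegative.\<close>
  have tangent: "(t - s) * (1 - p * ln 2) \<le> 0"
  proof (cases "log 2 (1 / (c * ln 2)) - r > 0")
    case True
    then have "r + s = log 2 (1 / (c * ln 2))" by (simp add: s)
    then have "2 powr (r + s) = 1 / (c * ln 2)" using \<open>0 < c\<close> by simp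
    then show ?thesis using \<open>0 < c\<close> by (simp add: p_def)
  next
    case False
    then have "s = 0" "log 2 (1 / (c * ln 2)) \<le> r" by (simp_all add: s)
    then have "1 / (c * ln 2) \<le> 2 powr (r + s)"
      using \<open>0 < c\<close> by (simp add: log_le_iff)
    then have "1 \<le> p * ln 2" using \<open>0 < c\<close> by (simp add: p_def field_simps)
    then show ?thesis using \<open>s = 0\<close> \<open>0 \<le> t\<close> by (simp add: mult_nonneg_nonpos)
  qed
  have "c * 2 powr (r + t) = p * 2 powr (t - s)"
    by (simp add: p_def flip: powr_add)
  then have "c * 2 powr (r + t) > p * (1 + (t - s) * ln 2)"
    using mult_strict_left_mono[OF ineq p] by simp
  with tangent show ?thesis by (simp add: p_def algebra_simps)
qed

section \<open>The Dinkelbach objective for a fixed parameter\<close>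

locale slm_system =
  fixes K :: nat and r \<rho> Pc :: real and \<omega> :: "nat \<Rightarrow> real"
  assumes K: "1 \<le> K" and r: "0 \<le> r" and rho: "0 < \<rho>" and Pc: "0 < Pc"
    and omega: "\<And>k. k \<in> {1..K} \<Longrightarrow> 0 < \<omega> k"
begin

abbreviation "N x \<equiv> real K * r + (\<Sum>k\<in>{1..K}. x k)"
abbreviation "D x \<equiv> 1 / \<rho> * tx_power K r \<omega> x + Pc"
abbreviation "sol \<equiv> dinkelbach_margin r \<omega> \<rho>"

lemma power_pos:
  assumes "x \<in> nonneg_margins K"
  shows "0 < D x"
proof -
  have "0 \<le> tx_power K r \<omega> x"
    unfolding tx_power_def
  proof (rule sum_nonneg)
    fix k assume k: "k \<in> {1..K}"
    then have "1 \<le> 2 powr (r + x k)"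
      using assms r by (intro ge_one_powr_ge_zero) (auto simp: nonneg_margins_def)
    then show "0 \<le> (2 powr (r + x k) - 1) / \<omega> k"
      using omega[OF k] by simp
  qed
  then show ?thesis
    using Pc rho by (simp add: add_nonneg_pos)
qed

lemma dinkelbach_margin_nonneg: "sol l \<in> nonneg_margins K"
  by (simp add: nonneg_margins_def dinkelbach_margin_def)

text \<open>The second summand does not depend on \<open>x\<close>, so maximisation splits into one
  problem per user.\<close>

lemma dinkelbach_objective_separable:
  "N x - l * D x = (\<Sum>k\<in>{1..K}. x k - l / (\<rho> * \<omega> k) * 2 powr (r + x k))
     + (real K * r + l / \<rho> * (\<Sum>k\<in>{1..K}. 1 / \<omega> k) - l * Pc)"
proof -
  define P where "P = (\<Sum>k\<in>{1..K}. 2 powr (r + x k) / \<omega> k)"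
  have "tx_power K r \<omega> x = P - (\<Sum>k\<in>{1..K}. 1 / \<omega> k)"
    by (simp add: tx_power_def P_def diff_divide_distrib sum_subtractf)
  moreover have "(\<Sum>k\<in>{1..K}. x k - l / (\<rho> * \<omega> k) * 2 powr (r + x k))
      = (\<Sum>k\<in>{1..K}. x k) - l / \<rho> * P"
    by (simp add: P_def sum_subtractf sum_distrib_left)
  ultimately show ?thesis
    by (simp add: right_diff_distrib distrib_left diff_divide_distrib)
qed

text \<open>The one-user result with \<open>c = l / (\<rho> * \<omega> k)\<close>, for which
  \<open>1 / (c * ln 2)\<close> is the argument of the logarithm in
  \<open>dinkelbach_margin\<close>.\<close>

lemma dinkelbach_margin_less:
  assumes "0 < l" and "k \<in> {1..K}" and "0 \<le> t" and "t \<noteq> sol l k"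
  shows "t - l / (\<rho> * \<omega> k) * 2 powr (r + t)
    < sol l k - l / (\<rho> * \<omega> k) * 2 powr (r + sol l k)"
  by (rule separable_term_less_max)
    (use assms rho omega[OF assms(2)] in \<open>simp_all add: dinkelbach_margin_def\<close>)

lemma dinkelbach_margin_optimal:
  assumes "0 < l" and y: "y \<in> nonneg_margins K"
  shows "N y - l * D y \<le> N (sol l) - l * D (sol l)"
  unfolding dinkelbach_objective_separable
proof (intro add_right_mono sum_mono)
  fix k assume k: "k \<in> {1..K}"
  then have "0 \<le> y k" using y by (simp add: nonneg_margins_def)
  with dinkelbach_margin_less[OF assms(1) k] show "y k - l / (\<rho> * \<omega> k) * 2 powr (r + y k)
      \<le> sol l k - l / (\<rho> * \<omega> k) * 2 powr (r + sol l k)"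
    by (cases "y k = sol l k") (auto intro: less_imp_le)
qed

text \<open>A deviation at a single user loses strictly, and no other user can compensate for
  it.\<close>

lemma dinkelbach_margin_unique:
  assumes "0 < l" and y: "y \<in> nonneg_margins K"
    and le: "N (sol l) - l * D (sol l) \<le> N y - l * D y" and k: "k \<in> {1..K}"
  shows "y k = sol l k"
proof (rule ccontr)
  assume neq: "y k \<noteq> sol l k"
  have nonneg: "0 \<le> y j" if "j \<in> {1..K}" for j
    using y that by (simp add: nonneg_margins_def)
  have "N y - l * D y < N (sol l) - l * D (sol l)"
    unfolding dinkelbach_objective_separable
  proof (intro add_strict_right_mono sum_strict_mono_ex1 ballI bexI[OF _ k])
    fix j assume j: "j \<in> {1..K}"
    show "y j - l / (\<rho> * \<omega> j) * 2 powr (r + y j)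
        \<le> sol l j - l / (\<rho> * \<omega> j) * 2 powr (r + sol l j)"
      using dinkelbach_margin_less[OF assms(1) j nonneg[OF j]]
      by (cases "y j = sol l j") (auto intro: less_imp_le)
  qed (use dinkelbach_margin_less[OF assms(1) k nonneg[OF k] neq] in auto)
  with le show False by simp
qed

section \<open>Existence of the Dinkelbach parameter and of an EE maximiser\<close>

text \<open>The intermediate value theorem applied to the optimal value \<open>F\<close> as a
  function of the parameter.\<close>

lemma dinkelbach_root:
  obtains l where "0 < l" and "N (sol l) = l * D (sol l)"
proof -
  define F where "F l = N (sol l) - l * D (sol l)" for l
  \<comment> \<open>Small enough that unit margins already give a positive objective: their sum rate
    is at least 1, while their weighted power is 1/2.\<close>
  define a where "a = 1 / (2 * D (\<lambda>_. 1))"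
  \<comment> \<open>Large enough to clip every margin to 0 (the last sum) and to be at least the EE
    of zero margins (the middle term), whence \<open>F b \<le> 0\<close>.\<close>
  define b where "b = a + real K * r / D (\<lambda>_. 0) + (\<Sum>k\<in>{1..K}. \<rho> * \<omega> k / ln 2)"
  have zero: "(\<lambda>_. 0) \<in> nonneg_margins K" by (simp add: nonneg_margins_def)
  note D0 = power_pos[OF zero]
  have one: "(\<lambda>_. 1) \<in> nonneg_margins K" by (simp add: nonneg_margins_def)
  note D1 = power_pos[OF one]
  have a: "0 < a" using D1 by (simp add: a_def)
  have "a * D (\<lambda>_. 1) = 1 / 2" using D1 by (simp add: a_def)
  moreover have "1 \<le> N (\<lambda>_. 1)" using K r by (simp add: add_increasing)
  ultimately have Fa: "0 \<le> F a"
    using dinkelbach_margin_optimal[OF a one] unfolding F_def by linarith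
  have terms: "0 < \<rho> * \<omega> k / ln 2" if "k \<in> {1..K}" for k
    using that rho omega by simp
  have "0 \<le> (\<Sum>k\<in>{1..K}. \<rho> * \<omega> k / ln 2)"
    using terms by (intro sum_nonneg less_imp_le)
  moreover have "0 \<le> real K * r / D (\<lambda>_. 0)"
    using r D0 by (intro divide_nonneg_pos) auto
  ultimately have b: "a \<le> b" "real K * r / D (\<lambda>_. 0) \<le> b" "(\<Sum>k\<in>{1..K}. \<rho> * \<omega> k / ln 2) \<le> b"
    using a by (simp_all add: b_def)
  have sol_b: "sol b k = 0" if k: "k \<in> {1..K}" for k
  proof -
    have "\<rho> * \<omega> k / ln 2 \<le> (\<Sum>k\<in>{1..K}. \<rho> * \<omega> k / ln 2)"
      using terms k by (intro member_le_sum) (auto intro: less_imp_le)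
    with b have "\<rho> * \<omega> k / ln 2 \<le> b" by linarith
    then have "\<rho> * \<omega> k / (b * ln 2) \<le> 1" using a b by (simp add: field_simps)
    moreover have "0 < \<rho> * \<omega> k / (b * ln 2)" using a b rho omega[OF k] by simp
    ultimately have "log 2 (\<rho> * \<omega> k / (b * ln 2)) \<le> 0" by (subst log_le_zero_cancel_iff) auto
    then show ?thesis using r by (simp add: dinkelbach_margin_def)
  qed
  have "F b = real K * r - b * D (\<lambda>_. 0)"
    unfolding F_def tx_power_def by (simp add: sol_b)
  also have "\<dots> \<le> 0"
    using b(2) D0 by (simp add: pos_divide_le_eq)
  finally have Fb: "F b \<le> 0" .
  have cont: "continuous_on {a..b} (\<lambda>l. sol l k)" if k: "k \<in> {1..K}" for k
  proof -
    have "0 < \<rho> * \<omega> k / (l * ln 2)" if "l \<in> {a..b}" for l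
      using a that rho omega[OF k] by simp
    moreover have "l * ln 2 \<noteq> 0" if "l \<in> {a..b}" for l
      using a that by simp
    ultimately show ?thesis
      unfolding dinkelbach_margin_def log_def
      by (intro continuous_intros) force+
  qed
  have "continuous_on {a..b} (\<lambda>l. tx_power K r \<omega> (sol l))"
    unfolding tx_power_def
  proof (intro continuous_on_sum)
    fix k assume k: "k \<in> {1..K}"
    show "continuous_on {a..b} (\<lambda>l. (2 powr (r + sol l k) - 1) / \<omega> k)"
      unfolding powr_def using omega[OF k] by (auto intro!: continuous_intros cont[OF k])
  qed
  then have "continuous_on {a..b} F"
    unfolding F_def by (intro continuous_intros cont)
  then obtain l where "a \<le> l" "F l = 0"
    using IVT2'[of F b 0 a] Fa Fb b(1) by blast
  with a show ?thesis by (intro that[of l]) (auto simp: F_def)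
qed

text \<open>At a root the maximum of \<open>N y - l * D y\<close> is 0, so every EE is at most
  \<open>l\<close>, and \<open>sol l\<close> attains it.\<close>

lemma is_arg_max_dinkelbach_margin:
  assumes "0 < l" and root: "N (sol l) = l * D (sol l)"
  shows "is_arg_max (EE K r \<omega> \<rho> Pc) (\<lambda>x. x \<in> nonneg_margins K) (sol l)"
proof -
  have "EE K r \<omega> \<rho> Pc y \<le> EE K r \<omega> \<rho> Pc (sol l)" if y: "y \<in> nonneg_margins K" for y
  proof -
    have "N y \<le> l * D y"
      using dinkelbach_margin_optimal[OF assms(1) y] root by simp
    then have "EE K r \<omega> \<rho> Pc y \<le> l"
      using power_pos[OF y] by (simp add: EE_def pos_divide_le_eq)
    also have "l = EE K r \<omega> \<rho> Pc (sol l)"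
      using power_pos[OF dinkelbach_margin_nonneg, of l] unfolding EE_def root by simp
    finally show ?thesis .
  qed
  then show ?thesis
    by (auto simp: is_arg_max_def dinkelbach_margin_nonneg not_less)
qed

lemma arg_max_exists: "\<exists>x. is_arg_max (EE K r \<omega> \<rho> Pc) (\<lambda>x. x \<in> nonneg_margins K) x"
  using dinkelbach_root is_arg_max_dinkelbach_margin by blast

section \<open>Structure of an arbitrary EE maximiser\<close>

text \<open>Every maximiser has the EE \<open>l\<close> of the root, hence attains the maximum 0 of
  the Dinkelbach objective, whose maximiser is unique on the users.\<close>

lemma arg_max_eq_dinkelbach_margin:
  assumes x: "is_arg_max (EE K r \<omega> \<rho> Pc) (\<lambda>x. x \<in> nonneg_margins K) x"
  shows "0 < EE K r \<omega> \<rho> Pc x"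
    and "k \<in> {1..K} \<Longrightarrow> x k = sol (EE K r \<omega> \<rho> Pc x) k"
proof -
  obtain l where l: "0 < l" "N (sol l) = l * D (sol l)" by (rule dinkelbach_root)
  have x_nonneg: "x \<in> nonneg_margins K" using x by (simp add: is_arg_max_def)
  note Dx = power_pos[OF x_nonneg]
  have "EE K r \<omega> \<rho> Pc x = EE K r \<omega> \<rho> Pc (sol l)"
    using x is_arg_max_dinkelbach_margin[OF l] unfolding is_arg_max_def
    by (metis linorder_less_linear)
  also have "\<dots> = l"
    using power_pos[OF dinkelbach_margin_nonneg, of l] unfolding EE_def l(2) by simp
  finally have EE: "EE K r \<omega> \<rho> Pc x = l" .
  then have "N x = l * D x"
    using Dx unfolding EE_def by (simp add: divide_eq_eq)
  then have "N (sol l) - l * D (sol l) \<le> N x - l * D x"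
    using l(2) by simp
  from dinkelbach_margin_unique[OF l(1) x_nonneg this] EE l(1)
  show "0 < EE K r \<omega> \<rho> Pc x" "k \<in> {1..K} \<Longrightarrow> x k = sol (EE K r \<omega> \<rho> Pc x) k"
    by simp_all
qed

lemma arg_max_unique:
  assumes x: "is_arg_max (EE K r \<omega> \<rho> Pc) (\<lambda>x. x \<in> nonneg_margins K) x"
    and y: "is_arg_max (EE K r \<omega> \<rho> Pc) (\<lambda>x. x \<in> nonneg_margins K) y"
    and k: "k \<in> {1..K}"
  shows "y k = x k"
proof -
  have "EE K r \<omega> \<rho> Pc x = EE K r \<omega> \<rho> Pc y"
    using x y unfolding is_arg_max_def by (metis linorder_less_linear)
  then show ?thesis
    using arg_max_eq_dinkelbach_margin(2)[OF x k] arg_max_eq_dinkelbach_margin(2)[OF y k] by simp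
qed

lemma active_margin:
  assumes x: "is_arg_max (EE K r \<omega> \<rho> Pc) (\<lambda>x. x \<in> nonneg_margins K) x" and "k \<in> {1..K}"
  shows "x k = (if k \<in> active_users K x
    then log 2 (\<rho> * \<omega> k / (EE K r \<omega> \<rho> Pc x * ln 2)) - r else 0)"
  using arg_max_eq_dinkelbach_margin(2)[OF assms] assms(2)
  by (auto simp: active_users_def dinkelbach_margin_def max_def)

text \<open>Inserting the margins, an active user transmits with power
  \<open>\<rho> / (l * ln 2) - 1 / \<omega> k\<close>. \<open>A_coeff\<close> and
  \<open>B_coeff\<close> collect what does not involve \<open>l\<close>.\<close>

lemma arg_max_coeffs:
  assumes x: "is_arg_max (EE K r \<omega> \<rho> Pc) (\<lambda>x. x \<in> nonneg_margins K) x"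
  defines "S \<equiv> active_users K x" and "l \<equiv> EE K r \<omega> \<rho> Pc x"
  shows "D x = A_coeff K r \<omega> \<rho> Pc S + real (card S) / (l * ln 2)"
    and "N x = B_coeff K r \<omega> \<rho> (real (card S)) S - real (card S) * log 2 l"
proof -
  have l: "0 < l" unfolding l_def by (rule arg_max_eq_dinkelbach_margin(1)[OF x])
  have S: "S \<subseteq> {1..K}" by (auto simp: S_def active_users_def)
  have active: "x k = log 2 (\<rho> * \<omega> k / (l * ln 2)) - r" if "k \<in> S" for k
    using active_margin[OF x, of k] that S by (auto simp: S_def l_def)
  have inactive: "x k = 0" if "k \<in> {1..K} - S" for k
    using active_margin[OF x, of k] that by (auto simp: S_def)
  have "(2 powr (r + x k) - 1) / \<omega> k = \<rho> / (l * ln 2) - 1 / \<omega> k" if k: "k \<in> S" for k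
  proof -
    have w: "0 < \<omega> k" using k S omega by blast
    have "r + x k = log 2 (\<rho> * \<omega> k / (l * ln 2))" using active[OF k] by simp
    then have "2 powr (r + x k) = \<rho> * \<omega> k / (l * ln 2)" using w rho l by simp
    then show ?thesis using w l by (simp add: field_simps)
  qed
  then have "(\<Sum>k\<in>S. (2 powr (r + x k) - 1) / \<omega> k)
      = real (card S) * (\<rho> / (l * ln 2)) - (\<Sum>k\<in>S. 1 / \<omega> k)"
    by (simp add: sum_subtractf)
  moreover have "(\<Sum>k\<in>{1..K} - S. (2 powr (r + x k) - 1) / \<omega> k)
      = (\<Sum>k\<in>{1..K} - S. (2 powr r - 1) / \<omega> k)"
    using inactive by (intro sum.cong) auto
  ultimately have "tx_power K r \<omega> x = (\<Sum>k\<in>{1..K} - S. (2 powr r - 1) / \<omega> k)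
      + (real (card S) * (\<rho> / (l * ln 2)) - (\<Sum>k\<in>S. 1 / \<omega> k))"
    unfolding tx_power_def by (subst sum.subset_diff[OF S]) auto
  then show "D x = A_coeff K r \<omega> \<rho> Pc S + real (card S) / (l * ln 2)"
    using rho by (simp add: A_coeff_def add_divide_distrib diff_divide_distrib)
  have "x k = log 2 (\<omega> k) + (log 2 (\<rho> / ln 2) - log 2 l - r)" if k: "k \<in> S" for k
  proof -
    have w: "0 < \<omega> k" using k S omega by blast
    have "\<rho> * \<omega> k / (l * ln 2) = \<omega> k * (\<rho> / ln 2) / l" by (simp add: mult_ac)
    then show ?thesis
      using w rho l by (simp add: active[OF k] log_mult_pos log_divide_pos del: times_divide_eq_right)
  qed
  then have "(\<Sum>k\<in>S. x k)
      = (\<Sum>k\<in>S. log 2 (\<omega> k)) + real (card S) * (log 2 (\<rho> / ln 2) - log 2 l - r)"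
    by (simp add: sum.distrib)
  \<comment> \<open>The \<open>- r\<close> of each active margin turns \<open>real K * r\<close>
    into the first summand of \<open>B_coeff\<close>.\<close>
  moreover have "(\<Sum>k\<in>{1..K}. x k) = (\<Sum>k\<in>S. x k)"
    using S inactive by (intro sum.mono_neutral_right) auto
  ultimately show "N x = B_coeff K r \<omega> \<rho> (real (card S)) S - real (card S) * log 2 l"
    by (simp add: B_coeff_def algebra_simps)
qed

text \<open>These are \<open>D x > 0\<close> and \<open>N x = l * D x\<close> in terms of the
  coefficients, the form that \<open>eta_SLM_eqI\<close> expects.\<close>

lemma arg_max_equation:
  assumes x: "is_arg_max (EE K r \<omega> \<rho> Pc) (\<lambda>x. x \<in> nonneg_margins K) x"
  defines "S \<equiv> active_users K x" and "l \<equiv> EE K r \<omega> \<rho> Pc x"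
  shows "0 < A_coeff K r \<omega> \<rho> Pc S + real (card S) / (l * ln 2)"
    and "l * A_coeff K r \<omega> \<rho> Pc S + real (card S) / ln 2
      = B_coeff K r \<omega> \<rho> (real (card S)) S - real (card S) * log 2 l"
proof -
  have l: "0 < l" unfolding l_def by (rule arg_max_eq_dinkelbach_margin(1)[OF x])
  have D: "0 < D x" using x by (intro power_pos) (simp add: is_arg_max_def)
  then have "N x = l * D x" by (simp add: l_def EE_def)
  with D l arg_max_coeffs[OF x] show
    "0 < A_coeff K r \<omega> \<rho> Pc S + real (card S) / (l * ln 2)"
    "l * A_coeff K r \<omega> \<rho> Pc S + real (card S) / ln 2
      = B_coeff K r \<omega> \<rho> (real (card S)) S - real (card S) * log 2 l"
    unfolding S_def[symmetric] l_def[symmetric] by (simp_all add: distrib_left)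
qed

section \<open>The transmit power budget\<close>

lemma feasible_iff:
  assumes "x \<in> nonneg_margins K"
  shows "x \<in> feasible_margins K r \<omega> PT \<longleftrightarrow>
    (\<Sum>k\<in>{1..K}. 2 powr x k / \<omega> k) \<le> 2 powr (- r) * (PT + (\<Sum>k\<in>{1..K}. 1 / \<omega> k))"
proof -
  have "tx_power K r \<omega> x = 2 powr r * (\<Sum>k\<in>{1..K}. 2 powr x k / \<omega> k) - (\<Sum>k\<in>{1..K}. 1 / \<omega> k)"
    by (simp add: tx_power_def diff_divide_distrib sum_subtractf sum_distrib_left powr_add)
  then show ?thesis
    using assms by (auto simp: feasible_margins_def nonneg_margins_def powr_minus field_simps)
qed

text \<open>A maximiser over the larger set that lies in the smaller one is also a maximiser there.
  Any other feasible maximiser has the same EE, hence is optimal over the larger set too, where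
  uniqueness applies.\<close>

lemma feasible_arg_max:
  assumes x: "is_arg_max (EE K r \<omega> \<rho> Pc) (\<lambda>x. x \<in> nonneg_margins K) x"
    and feas: "x \<in> feasible_margins K r \<omega> PT"
  shows "is_arg_max (EE K r \<omega> \<rho> Pc) (\<lambda>y. y \<in> feasible_margins K r \<omega> PT) x"
    and "is_arg_max (EE K r \<omega> \<rho> Pc) (\<lambda>y. y \<in> feasible_margins K r \<omega> PT) y \<Longrightarrow>
      k \<in> {1..K} \<Longrightarrow> y k = x k"
proof -
  have sub: "feasible_margins K r \<omega> PT \<subseteq> nonneg_margins K"
    by (auto simp: feasible_margins_def nonneg_margins_def)
  with x feas show "is_arg_max (EE K r \<omega> \<rho> Pc) (\<lambda>y. y \<in> feasible_margins K r \<omega> PT) x"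
    by (auto simp: is_arg_max_def)
  assume y: "is_arg_max (EE K r \<omega> \<rho> Pc) (\<lambda>y. y \<in> feasible_margins K r \<omega> PT) y"
    and k: "k \<in> {1..K}"
  have "is_arg_max (EE K r \<omega> \<rho> Pc) (\<lambda>x. x \<in> nonneg_margins K) y"
    using x y feas sub unfolding is_arg_max_def by (meson linorder_not_less order_less_le_trans subsetD)
  from arg_max_unique[OF x this k] show "y k = x k" .
qed

section \<open>The case without active users\<close>

text \<open>This coefficient is the total power consumed at zero margins.\<close>

lemma A_coeff_empty_pos: "0 < A_coeff K r \<omega> \<rho> Pc {}"
proof -
  have "D (\<lambda>_. 0) = A_coeff K r \<omega> \<rho> Pc {}"
    by (simp add: tx_power_def A_coeff_def)
  then show ?thesis using power_pos[of "\<lambda>_. 0"] by (simp add: nonneg_margins_def)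
qed

lemma eta_SLM_empty_tendsto:
  "((\<lambda>\<kappa>. eta_SLM \<kappa> (A_coeff K r \<omega> \<rho> Pc {}) (B_coeff K r \<omega> \<rho> \<kappa> {}))
    \<longlongrightarrow> B_coeff K r \<omega> \<rho> 0 {} / A_coeff K r \<omega> \<rho> Pc {}) (at_right 0)"
proof (rule eta_SLM_tendsto_at_right_0[OF A_coeff_empty_pos])
  show "0 \<le> B_coeff K r \<omega> \<rho> 0 {}" using r by (simp add: B_coeff_def)
  show "((\<lambda>\<kappa>. B_coeff K r \<omega> \<rho> \<kappa> {}) \<longlongrightarrow> B_coeff K r \<omega> \<rho> 0 {}) (at_right 0)"
    unfolding B_coeff_def by (intro tendsto_intros)
qed

end
text \<open>Optimality is first taken over nonnegative margins, and the budget is then a test on the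
  result: a solution that passes is the unique constrained optimum. Since \<open>eta_SLM\<close>
  divides by \<open>A\<close> and \<kappa>, \<open>A = 0\<close> and the empty active set are stated
  separately.\<close>

theorem lemma1:
  fixes K :: nat and r \<rho> Pc PT :: real and \<omega> :: "nat \<Rightarrow> real"
  assumes "1 \<le> K" and "0 \<le> r" and "0 < \<rho>" and "0 < Pc"
    and "\<And>k. k \<in> {1..K} \<Longrightarrow> 0 < \<omega> k"
  shows
    "(\<exists>x. is_arg_max (EE K r \<omega> \<rho> Pc) (\<lambda>x. x \<in> nonneg_margins K) x) \<and>
     (\<forall>x. is_arg_max (EE K r \<omega> \<rho> Pc) (\<lambda>x. x \<in> nonneg_margins K) x \<longrightarrow>
       (let S = active_users K x;
            A = A_coeff K r \<omega> \<rho> Pc S;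
            B = B_coeff K r \<omega> \<rho> (real (card S)) S;
            lam = EE K r \<omega> \<rho> Pc x
        in (S \<noteq> {} \<and> A \<noteq> 0 \<longrightarrow> lam = eta_SLM (real (card S)) A B) \<and>
           (S \<noteq> {} \<and> A = 0 \<longrightarrow> ((\<lambda>a. eta_SLM (real (card S)) a B) \<longlongrightarrow> lam) (at 0)) \<and>
           (S = {} \<longrightarrow> lam = B / A) \<and>
           (\<forall>k\<in>{1..K}. x k = (if k \<in> S then log 2 (\<rho> * \<omega> k / (lam * ln 2)) - r else 0)) \<and>
           (x \<in> feasible_margins K r \<omega> PT \<longleftrightarrow>
             (\<Sum>k\<in>{1..K}. 2 powr x k / \<omega> k)
               \<le> 2 powr (- r) * (PT + (\<Sum>k\<in>{1..K}. 1 / \<omega> k))) \<and>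
           (x \<in> feasible_margins K r \<omega> PT \<longrightarrow>
             is_arg_max (EE K r \<omega> \<rho> Pc) (\<lambda>y. y \<in> feasible_margins K r \<omega> PT) x \<and>
             (\<forall>y. is_arg_max (EE K r \<omega> \<rho> Pc) (\<lambda>y. y \<in> feasible_margins K r \<omega> PT) y \<longrightarrow>
               (\<forall>k\<in>{1..K}. y k = x k))))) \<and>
     ((\<lambda>\<kappa>. eta_SLM \<kappa> (A_coeff K r \<omega> \<rho> Pc {}) (B_coeff K r \<omega> \<rho> \<kappa> {}))
        \<longlongrightarrow> B_coeff K r \<omega> \<rho> 0 {} / A_coeff K r \<omega> \<rho> Pc {}) (at_right 0) \<and>
     B_coeff K r \<omega> \<rho> 0 {} / A_coeff K r \<omega> \<rho> Pc {} =
       real K * r / (1 / \<rho> * (\<Sum>k\<in>{1..K}. (2 powr r - 1) / \<omega> k) + Pc)"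
proof -
  interpret slm_system K r \<rho> Pc \<omega>
    using assms by unfold_locales
  show ?thesis
  proof (intro conjI allI impI)
    show "\<exists>x. is_arg_max (EE K r \<omega> \<rho> Pc) (\<lambda>x. x \<in> nonneg_margins K) x"
      by (rule arg_max_exists)
  next
    fix x assume x: "is_arg_max (EE K r \<omega> \<rho> Pc) (\<lambda>x. x \<in> nonneg_margins K) x"
    define S where "S = active_users K x"
    define A where "A = A_coeff K r \<omega> \<rho> Pc S"
    define B where "B = B_coeff K r \<omega> \<rho> (real (card S)) S"
    define lam where "lam = EE K r \<omega> \<rho> Pc x"
    have lam: "0 < lam"
      unfolding lam_def by (rule arg_max_eq_dinkelbach_margin(1)[OF x])
    have pos: "0 < A + real (card S) / (lam * ln 2)"
      and eq: "lam * A + real (card S) / ln 2 = B - real (card S) * log 2 lam"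
      using arg_max_equation[OF x] by (simp_all add: S_def A_def B_def lam_def)
    have "finite S" by (simp add: S_def active_users_def)
    then have card: "0 < real (card S)" if "S \<noteq> {}"
      using that by (simp add: card_gt_0_iff)
    have "lam = eta_SLM (real (card S)) A B" if "S \<noteq> {}" "A \<noteq> 0"
      using eta_SLM_eqI[OF card[OF that(1)] lam that(2) pos eq] by simp
    moreover have "((\<lambda>a. eta_SLM (real (card S)) a B) \<longlongrightarrow> lam) (at 0)" if "S \<noteq> {}" "A = 0"
    proof -
      note c = card[OF that(1)]
      \<comment> \<open>With \<open>A = 0\<close> the equation determines \<open>lam\<close>
        explicitly, and its value is the limit in \<open>eta_SLM_tendsto_at_0\<close>.\<close>
      have "B = real (card S) / ln 2 + real (card S) * log 2 lam" using eq that(2) by simp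
      then have "B * ln 2 / real (card S) - 1 = ln lam" using c by (simp add: log_def field_simps)
      then show ?thesis
        using eta_SLM_tendsto_at_0[OF c, of B] lam by simp
    qed
    \<comment> \<open>Here \<open>card S = 0\<close>, so the equation collapses to
      \<open>lam * A = B\<close> with \<open>A > 0\<close>.\<close>
    moreover have "lam = B / A" if "S = {}"
      using eq pos that by (simp add: field_simps)
    moreover have "x \<in> nonneg_margins K" using x by (simp add: is_arg_max_def)
    ultimately show "let S = active_users K x;
              A = A_coeff K r \<omega> \<rho> Pc S;
              B = B_coeff K r \<omega> \<rho> (real (card S)) S;
              lam = EE K r \<omega> \<rho> Pc x
          in (S \<noteq> {} \<and> A \<noteq> 0 \<longrightarrow> lam = eta_SLM (real (card S)) A B) \<and>
             (S \<noteq> {} \<and> A = 0 \<longrightarrow> ((\<lambda>a. eta_SLM (real (card S)) a B) \<longlongrightarrow> lam) (at 0)) \<and>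
             (S = {} \<longrightarrow> lam = B / A) \<and>
             (\<forall>k\<in>{1..K}. x k = (if k \<in> S then log 2 (\<rho> * \<omega> k / (lam * ln 2)) - r else 0)) \<and>
             (x \<in> feasible_margins K r \<omega> PT \<longleftrightarrow>
               (\<Sum>k\<in>{1..K}. 2 powr x k / \<omega> k)
                 \<le> 2 powr (- r) * (PT + (\<Sum>k\<in>{1..K}. 1 / \<omega> k))) \<and>
             (x \<in> feasible_margins K r \<omega> PT \<longrightarrow>
               is_arg_max (EE K r \<omega> \<rho> Pc) (\<lambda>y. y \<in> feasible_margins K r \<omega> PT) x \<and>
               (\<forall>y. is_arg_max (EE K r \<omega> \<rho> Pc) (\<lambda>y. y \<in> feasible_margins K r \<omega> PT) y \<longrightarrow>
                 (\<forall>k\<in>{1..K}. y k = x k)))"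
      unfolding Let_def S_def[symmetric] A_def[symmetric] B_def[symmetric] lam_def[symmetric]
      using active_margin[OF x, folded S_def lam_def] feasible_arg_max[OF x]
      by (intro conjI impI ballI allI feasible_iff) simp_all
  next
    show "((\<lambda>\<kappa>. eta_SLM \<kappa> (A_coeff K r \<omega> \<rho> Pc {}) (B_coeff K r \<omega> \<rho> \<kappa> {}))
          \<longlongrightarrow> B_coeff K r \<omega> \<rho> 0 {} / A_coeff K r \<omega> \<rho> Pc {}) (at_right 0)"
      by (rule eta_SLM_empty_tendsto)
  next
    show "B_coeff K r \<omega> \<rho> 0 {} / A_coeff K r \<omega> \<rho> Pc {} =
         real K * r / (1 / \<rho> * (\<Sum>k\<in>{1..K}. (2 powr r - 1) / \<omega> k) + Pc)"
      by (simp add: A_coeff_def B_coeff_def add.commute)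
  qed
qed

end
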